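(* Let $n,m\ge 1$, let $\mathcal{P}$ be an $n$-polytope with base flag $\Phi$ and let $\mathcal{Q}$ be an $m$-polytope with base flag $\Psi$. Let $\mathcal{M} = \mathcal{P} | \mathcal{Q}$ be their flat amalgamation. 1. Each connected component of $\mathcal{M}[0, \ldots, n-1]$ is isomorphic to $\mathcal{P}$ if and only if $\mathcal{P}$ is facet-bipartite. 2. Each connected component of $\mathcal{M}[n-1, \ldots, m+n-2]$ is isomorphic to $\mathcal{Q}$ (with the edge labels of $\mathcal{Q}$ increased by $n-1$) if and only if $\mathcal{Q}$ is vertex-bipartite.
   Context: For an integer $n\ge 1$, an $n$-pre-maniplex is an $n$-regular simple graph (its nodes are called flags) whose edges are colored (labeled) with $0,1,\ldots,n-1$ so that each flag is incident to exactly one edge of each color; $\Phi^i$ denotes the other endpoint of the edge of color $i$ at the flag $\Phi$. An $n$-maniplex is a connected $n$-pre-maniplex in which $(\Phi^i)^j=(\Phi^j)^i$ for every flag $\Phi$ and all colors $i,j$ with $|i-j|>1$. An $n$-polytope (identified with its flag graph) is an $n$-maniplex satisfying the Path Intersection Property: for every pair of flags $\Phi,\Psi$ and all colors $i\le j$, if there is a path from $\Phi$ to $\Psi$ using only colors in $\{i,\ldots,n-1\}$ and another path from $\Phi$ to $\Psi$ using only colors in $\{0,\ldots,j\}$, then there is a path from $\Phi$ to $\Psi$ using only colors in $\{i,\ldots,j\}$. For an edge-colored graph $\mathcal{G}$, $\mathcal{G}[i_1,\ldots,i_r]$ denotes the subgraph with the same nodes and only the edges of colors $i_1,\ldots,i_r$.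 Isomorphisms are color-preserving graph isomorphisms. An $n$-polytope is facet-bipartite if it has no cycle with an odd number of edges of color $n-1$, and vertex-bipartite if it has no cycle with an odd number of edges of color $0$. Flat amalgamation: let $\mathcal{P}$ be an $n$-polytope with base flag $\Phi$ and $\mathcal{Q}$ an $m$-polytope with base flag $\Psi$. On pairs $(\Lambda,\Delta)$ with $\Lambda$ a flag of $\mathcal{P}$ and $\Delta$ a flag of $\mathcal{Q}$, define for $0\le i\le m+n-2$: $(\Lambda,\Delta)^i=(\Lambda^i,\Delta)$ if $i<n-1$; $(\Lambda,\Delta)^{n-1}=(\Lambda^{n-1},\Delta^0)$; $(\Lambda,\Delta)^i=(\Lambda,\Delta^{i-n+1})$ if $n\le i\le m+n-2$. Join $(\Lambda,\Delta)$ to $(\Lambda,\Delta)^i$ by an edge of color $i$. The flat amalgamation $\mathcal{P}|\mathcal{Q}=(\mathcal{P},\Phi)|(\mathcal{Q},\Psi)$ is the connected component of this edge-colored graph that contains $(\Phi,\Psi)$. *)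

theory Defs
  imports Main
begin

text \<open>An element \<open>(i, e)\<close> of \<open>cedges G\<close> is an undirected edge \<open>e = {u, v}\<close> of color \<open>i\<close>.
  Nothing is required of the raw record; well-formedness is part of \<open>pre_maniplex\<close>.\<close>

record 'a cgraph =
  flags :: "'a set"
  cedges :: "(nat \<times> 'a set) set"

text \<open>The second conjunct excludes parallel edges.  Regularity of degree \<open>n\<close> is not listed
  separately: it follows from the three conjuncts, since the edges at a flag correspond
  bijectively to the colors below \<open>n\<close>.\<close>

definition pre_maniplex :: "nat \<Rightarrow> 'a cgraph \<Rightarrow> bool" where
  "pre_maniplex n G \<longleftrightarrow>
     (\<forall>(i, e) \<in> cedges G. i < n \<and> (\<exists>u \<in> flags G. \<exists>v \<in> flags G. u \<noteq> v \<and> e = {u, v})) \<and>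
     (\<forall>i j e. (i, e) \<in> cedges G \<and> (j, e) \<in> cedges G \<longrightarrow> i = j) \<and>
     (\<forall>u \<in> flags G. \<forall>i < n. \<exists>!e. (i, e) \<in> cedges G \<and> u \<in> e)"

definition nb :: "'a cgraph \<Rightarrow> 'a \<Rightarrow> nat \<Rightarrow> 'a" where
  "nb G u i = (THE v. (i, {u, v}) \<in> cedges G)"

definition reach :: "'a cgraph \<Rightarrow> nat set \<Rightarrow> 'a \<Rightarrow> 'a \<Rightarrow> bool" where
  "reach G I = (\<lambda>u v. \<exists>i \<in> I. (i, {u, v}) \<in> cedges G)\<^sup>*\<^sup>*"

definition connected_cgraph :: "'a cgraph \<Rightarrow> bool" where
  "connected_cgraph G \<longleftrightarrow> (\<forall>u \<in> flags G. \<forall>v \<in> flags G. reach G UNIV u v)"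

definition maniplex :: "nat \<Rightarrow> 'a cgraph \<Rightarrow> bool" where
  "maniplex n G \<longleftrightarrow> pre_maniplex n G \<and> connected_cgraph G \<and>
     (\<forall>u \<in> flags G. \<forall>i < n. \<forall>j < n. \<bar>int i - int j\<bar> > 1 \<longrightarrow>
        nb G (nb G u i) j = nb G (nb G u j) i)"

definition path_intersection :: "nat \<Rightarrow> 'a cgraph \<Rightarrow> bool" where
  "path_intersection n G \<longleftrightarrow>
     (\<forall>u \<in> flags G. \<forall>v \<in> flags G. \<forall>i j. i \<le> j \<and> j < n \<longrightarrow>
        reach G {i..n - 1} u v \<and> reach G {0..j} u v \<longrightarrow> reach G {i..j} u v)"

definition polytope :: "nat \<Rightarrow> 'a cgraph \<Rightarrow> bool" where
  "polytope n G \<longleftrightarrow> maniplex n G \<and> path_intersection n G"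

text \<open>A cycle in the graph-theoretic sense, without repeated vertices: \<open>us\<close> lists its vertices
  and \<open>cs ! k\<close> is the color of the edge leaving the \<open>k\<close>-th of them.\<close>

definition is_cycle :: "'a cgraph \<Rightarrow> 'a list \<Rightarrow> nat list \<Rightarrow> bool" where
  "is_cycle G us cs \<longleftrightarrow> length us \<ge> 3 \<and> distinct us \<and> set us \<subseteq> flags G \<and>
     length cs = length us \<and>
     (\<forall>k < length us. (cs ! k, {us ! k, us ! (Suc k mod length us)}) \<in> cedges G)"

definition facet_bipartite :: "nat \<Rightarrow> 'a cgraph \<Rightarrow> bool" where
  "facet_bipartite n G \<longleftrightarrow> \<not> (\<exists>us cs. is_cycle G us cs \<and> odd (count_list cs (n - 1)))"

definition vertex_bipartite :: "'a cgraph \<Rightarrow> bool" where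
  "vertex_bipartite G \<longleftrightarrow> \<not> (\<exists>us cs. is_cycle G us cs \<and> odd (count_list cs 0))"

definition color_restrict :: "'a cgraph \<Rightarrow> nat set \<Rightarrow> 'a cgraph" where
  "color_restrict G I = \<lparr>flags = flags G, cedges = {(i, e) \<in> cedges G. i \<in> I}\<rparr>"

definition component_of :: "'a cgraph \<Rightarrow> 'a \<Rightarrow> 'a cgraph" where
  "component_of G u =
     (let W = {v \<in> flags G. reach G UNIV u v}
      in \<lparr>flags = W, cedges = {(i, e) \<in> cedges G. e \<subseteq> W}\<rparr>)"

definition components_of :: "'a cgraph \<Rightarrow> 'a cgraph set" where
  "components_of G = component_of G ` flags G"

definition shift_colors :: "nat \<Rightarrow> 'a cgraph \<Rightarrow> 'a cgraph" where
  "shift_colors k G = \<lparr>flags = flags G, cedges = {(i + k, e) | i e. (i, e) \<in> cedges G}\<rparr>"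

definition cgraph_iso :: "'a cgraph \<Rightarrow> 'b cgraph \<Rightarrow> bool" where
  "cgraph_iso G H \<longleftrightarrow> (\<exists>f. bij_betw f (flags G) (flags H) \<and>
     (\<forall>i. \<forall>u \<in> flags G. \<forall>v \<in> flags G.
        (i, {u, v}) \<in> cedges G \<longleftrightarrow> (i, {f u, f v}) \<in> cedges H))"

definition flat_nb :: "nat \<Rightarrow> 'a cgraph \<Rightarrow> 'b cgraph \<Rightarrow> 'a \<times> 'b \<Rightarrow> nat \<Rightarrow> 'a \<times> 'b" where
  "flat_nb n P Q x i =
     (if i < n - 1 then (nb P (fst x) i, snd x)
      else if i = n - 1 then (nb P (fst x) (n - 1), nb Q (snd x) 0)
      else (fst x, nb Q (snd x) (i - (n - 1))))"

definition flat_graph :: "nat \<Rightarrow> nat \<Rightarrow> 'a cgraph \<Rightarrow> 'b cgraph \<Rightarrow> ('a \<times> 'b) cgraph" where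
  "flat_graph n m P Q =
     \<lparr>flags = flags P \<times> flags Q,
      cedges = {(i, {x, flat_nb n P Q x i}) | i x. i \<le> m + n - 2 \<and> x \<in> flags P \<times> flags Q}\<rparr>"

definition flat_amalgamation ::
    "nat \<Rightarrow> 'a cgraph \<Rightarrow> 'a \<Rightarrow> nat \<Rightarrow> 'b cgraph \<Rightarrow> 'b \<Rightarrow> ('a \<times> 'b) cgraph" where
  "flat_amalgamation n P \<Phi> m Q \<Psi> = component_of (flat_graph n m P Q) (\<Phi>, \<Psi>)"

end

theory Submission
  imports Defs
begin

text \<open>
  A component of \<open>\<M>[0, \<dots>, n - 1]\<close> through \<open>(\<Lambda>, \<Delta>)\<close> only visits the second coordinates \<open>\<Delta>\<close> and
  \<open>\<Delta>\<^sup>0\<close>, and these are exchanged exactly by the edges of color \<open>n - 1\<close>. So it covers \<open>\<P>\<close> with one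
  or two sheets, and the sheet is a two-coloring that only the edges of color \<open>n - 1\<close> alternate.
  If the component is isomorphic to \<open>\<P>\<close> (by any isomorphism, not necessarily the projection), this
  two-coloring moves to \<open>\<P>\<close> and makes it facet-bipartite. If \<open>\<P>\<close> is facet-bipartite, then it has
  such a two-coloring, which makes the sheet a function of the first coordinate, so that the
  projection to \<open>\<P>\<close> is an isomorphism. The second part is the same argument with the coordinates
  exchanged.
\<close>

section \<open>Two-colorings and odd cycles\<close>

definition alternates_on :: "nat \<Rightarrow> 'a cgraph \<Rightarrow> ('a \<Rightarrow> bool) \<Rightarrow> bool" where
  "alternates_on c G s \<longleftrightarrow> (\<forall>i u v. (i, {u, v}) \<in> cedges G \<longrightarrow> (s u \<noteq> s v \<longleftrightarrow> i = c))"

text \<open>The negation is \<open>facet_bipartite\<close> for \<open>c = n - 1\<close> and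
  \<open>vertex_bipartite\<close> for \<open>c = 0\<close>, so one argument serves both.\<close>

definition has_odd_cycle :: "nat \<Rightarrow> 'a cgraph \<Rightarrow> bool" where
  "has_odd_cycle c G \<longleftrightarrow> (\<exists>us cs. is_cycle G us cs \<and> odd (count_list cs c))"

text \<open>\<open>s\<close> flips exactly at the edges of color \<open>c\<close> and is back at its
  initial value after a full turn, so it flips an even number of times.\<close>

lemma alternates_on_imp_no_odd_cycle:
  assumes "alternates_on c G s"
  shows "\<not> has_odd_cycle c G"
proof
  assume "has_odd_cycle c G"
  then obtain us cs where cyc: "is_cycle G us cs" and odd: "odd (count_list cs c)"
    unfolding has_odd_cycle_def by blast
  let ?L = "length us"
  have L: "?L \<ge> 3" "length cs = ?L"
    and edge: "\<And>k. k < ?L \<Longrightarrow> (cs ! k, {us ! k, us ! (Suc k mod ?L)}) \<in> cedges G"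
    using cyc unfolding is_cycle_def by auto
  \<comment> \<open>The index is taken modulo the length so that \<open>k = ?L\<close> is allowed,
    where the cycle has closed up.\<close>
  have "k \<le> ?L \<Longrightarrow>
      s (us ! (k mod ?L)) \<noteq> s (us ! 0) \<longleftrightarrow> odd (count_list (take k cs) c)" for k
  proof (induction k)
    case 0
    then show ?case by simp
  next
    case (Suc k)
    then have "s (us ! k) \<noteq> s (us ! (Suc k mod ?L)) \<longleftrightarrow> cs ! k = c"
      using edge[of k] assms unfolding alternates_on_def by auto
    moreover have "take (Suc k) cs = take k cs @ [cs ! k]"
      using Suc.prems L by (simp add: take_Suc_conv_app_nth)
    ultimately show ?case
      using Suc by auto
  qed
  from this[of ?L] show False
    using odd L by simp
qed

text \<open>A walk is given by its start and the list of its steps, each a color with the vertex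
  reached.\<close>

fun walk :: "'a cgraph \<Rightarrow> 'a \<Rightarrow> (nat \<times> 'a) list \<Rightarrow> 'a \<Rightarrow> bool" where
  "walk G u [] v \<longleftrightarrow> u = v"
| "walk G u ((i, w) # xs) v \<longleftrightarrow> (i, {u, w}) \<in> cedges G \<and> walk G w xs v"

lemma walk_append: "walk G u (xs @ ys) v \<longleftrightarrow> (\<exists>w. walk G u xs w \<and> walk G w ys v)"
  by (induction xs arbitrary: u) auto

lemma walk_nth_edge:
  "walk G u xs v \<Longrightarrow> k < length xs \<Longrightarrow>
     (fst (xs ! k), {(u # map snd xs) ! k, snd (xs ! k)}) \<in> cedges G"
proof (induction xs arbitrary: u k)
  case (Cons x xs)
  then show ?case
    by (cases x; cases k) auto
qed simp

lemma walk_last: "walk G u xs v \<Longrightarrow> last (u # map snd xs) = v"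
  by (induction xs arbitrary: u) auto

text \<open>Edges are undirected. The equal counts allow two walks with common ends to be joined to
  a closed walk of known parity.\<close>

lemma walk_rev:
  "walk G u xs v \<Longrightarrow>
     \<exists>ys. walk G v ys u \<and> (\<forall>c. count_list (map fst ys) c = count_list (map fst xs) c)"
proof (induction xs arbitrary: u)
  case Nil
  then show ?case
    by (intro exI[of _ "[]"]) simp
next
  case (Cons x xs)
  obtain i w where x: "x = (i, w)"
    by fastforce
  then have e: "(i, {w, u}) \<in> cedges G" and "walk G w xs v"
    using Cons.prems by (auto simp: insert_commute)
  then obtain ys where ys: "walk G v ys w"
      "\<forall>c. count_list (map fst ys) c = count_list (map fst xs) c"
    using Cons.IH by blast
  have "walk G v (ys @ [(i, u)]) u"
    using ys(1) e by (auto simp: walk_append)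
  then show ?case
    using ys(2) x by (intro exI[of _ "ys @ [(i, u)]"]) auto
qed

lemma reach_imp_walk: "reach G I u v \<Longrightarrow> \<exists>xs. walk G u xs v"
  unfolding reach_def
proof (induction rule: rtranclp_induct)
  case base
  have "walk G u [] u"
    by simp
  then show ?case by blast
next
  case (step w v)
  then obtain xs i where "walk G u xs w" "(i, {w, v}) \<in> cedges G"
    by blast
  then have "walk G u (xs @ [(i, v)]) v"
    by (auto simp: walk_append)
  then show ?case by blast
qed

lemma nth_rotate1_Suc_mod:
  "k < length xs \<Longrightarrow> rotate1 xs ! k = xs ! (Suc k mod length xs)"
  using nth_rotate[of k xs 1] by simp

lemma count_list_rotate1: "count_list (rotate1 xs) c = count_list xs c"
  by (cases xs) auto

lemma pre_maniplex_edgeE: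
  assumes "pre_maniplex n G" and "(i, {u, v}) \<in> cedges G"
  obtains "i < n" "u \<in> flags G" "v \<in> flags G" "u \<noteq> v"
proof -
  obtain a b where "i < n" "a \<in> flags G" "b \<in> flags G" "a \<noteq> b" "{u, v} = {a, b}"
    using assms unfolding pre_maniplex_def by fastforce
  then show thesis
    using that by (metis doubleton_eq_iff)
qed

text \<open>A shortest closed walk with an odd number of \<open>c\<close>-edges is a cycle: at a repeated vertex it
  would split into two closed walks, one of them odd.\<close>

lemma odd_closed_walk_imp_odd_cycle:
  assumes pre: "pre_maniplex n G"
    and "walk G u xs u" and "odd (count_list (map fst xs) c)"
  shows "has_odd_cycle c G"
proof -
  let ?odd_walk = "\<lambda>(u, xs). walk G u xs u \<and> odd (count_list (map fst xs) c)"
  have "?odd_walk (u, xs)"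
    using assms by simp
  from ex_has_least_nat[of ?odd_walk, OF this, of "\<lambda>(u, xs). length xs"]
  obtain v ys where w: "walk G v ys v" and odd: "odd (count_list (map fst ys) c)"
    and least: "\<And>w zs. walk G w zs w \<Longrightarrow> odd (count_list (map fst zs) c) \<Longrightarrow> length ys \<le> length zs"
    by auto
  have dist: "distinct (map snd ys)"
  proof (rule ccontr)
    assume "\<not> distinct (map snd ys)"
    then obtain as bs cs y where "map snd ys = as @ [y] @ bs @ [y] @ cs"
      using not_distinct_decomp by blast
    then obtain as' i bs' j cs' where ys: "ys = as' @ [(i, y)] @ bs' @ [(j, y)] @ cs'"
      by (clarsimp simp: map_eq_append_conv map_eq_Cons_conv Cons_eq_map_conv append_eq_map_conv)
    then have "walk G y (bs' @ [(j, y)]) y" "walk G v (as' @ [(i, y)] @ cs') v"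
      using w by (auto simp: walk_append)
    from least[OF this(1)] least[OF this(2)] show False
      using odd ys by (auto split: if_splits)
  qed
  \<comment> \<open>A step of a walk carries its color with the vertex it reaches,
    \<open>is_cycle\<close> with the vertex it leaves; rotation by one converts between the
    two.\<close>
  let ?us = "map snd ys" and ?cs = "rotate1 (map fst ys)"
  let ?L = "length ys"
  have L0: "ys \<noteq> []"
    using odd by auto
  then have v: "v = ?us ! (?L - 1)"
    using walk_last[OF w] by (simp add: last_map last_conv_nth)
  have edge: "(?cs ! k, {?us ! k, ?us ! (Suc k mod ?L)}) \<in> cedges G" if "k < ?L" for k
  proof (cases "Suc k < ?L")
    case True
    then show ?thesis
      using walk_nth_edge[OF w True] by (simp add: nth_rotate1_Suc_mod)
  next
    \<comment> \<open>The edge closing the cycle is the first step of the walk, since the start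
      \<open>v\<close> is also the last listed vertex.\<close>
    case False
    then have "Suc k = ?L" "?L - 1 = k"
      using that by simp_all
    then show ?thesis
      using walk_nth_edge[OF w, of 0] v L0 by (auto simp: nth_rotate1_Suc_mod)
  qed
  \<comment> \<open>Length 1 would be a loop. Length 2 goes back and forth between two flags;
    without parallel edges both colors agree and the count is even.\<close>
  have "?L \<ge> 3"
  proof (rule ccontr)
    assume "\<not> ?L \<ge> 3"
    then consider "?L = 1" | "?L = 2"
      using L0 by (cases ys) (auto simp: numeral_eq_Suc not_le less_Suc_eq)
    then show False
    proof cases
      case 1
      then show False
        using edge[of 0] pre_maniplex_edgeE[OF pre, of "?cs ! 0" "?us ! 0" "?us ! 0"] by auto
    next
      case 2
      then obtain i a j b where ys: "ys = [(i, a), (j, b)]"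
        by (auto simp: numeral_eq_Suc length_Suc_conv)
      then have "(j, {a, b}) \<in> cedges G" "(i, {a, b}) \<in> cedges G"
        using edge[of 0] edge[of 1] by (auto simp: insert_commute)
      then have "i = j"
        using pre unfolding pre_maniplex_def by blast
      then show False
        using odd ys by (auto split: if_splits)
    qed
  qed
  moreover have "set ?us \<subseteq> flags G"
  proof
    fix y assume "y \<in> set ?us"
    then obtain k where "k < ?L" "y = ?us ! k"
      by (auto simp: in_set_conv_nth)
    then show "y \<in> flags G"
      using edge[of k] pre by (metis pre_maniplex_edgeE)
  qed
  ultimately have "is_cycle G ?us ?cs"
    unfolding is_cycle_def using dist edge by simp
  then show ?thesis
    unfolding has_odd_cycle_def using odd count_list_rotate1 by metis
qed

text \<open>Each flag is colored by the parity of the number of \<open>c\<close>-edges on a walk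
  from a fixed root. Two walks of different parity would form an odd closed walk, hence yield an odd
  cycle.\<close>

lemma no_odd_cycle_imp_alternates_on:
  assumes pre: "pre_maniplex n G" and conn: "connected_cgraph G" and no: "\<not> has_odd_cycle c G"
  obtains s where "alternates_on c G s"
proof (cases "flags G = {}")
  case True
  then have "alternates_on c G (\<lambda>_. True)"
    using pre unfolding alternates_on_def by (auto elim: pre_maniplex_edgeE)
  then show thesis by (rule that)
next
  case False
  then obtain r where r: "r \<in> flags G" by blast
  define par where "par xs = odd (count_list (map fst xs) c)" for xs :: "(nat \<times> 'a) list"
  have uniq: "par xs = par ys" if xs: "walk G r xs v" and ys: "walk G r ys v" for xs ys v
  proof -
    obtain zs where zs: "walk G v zs r"
        "\<forall>c. count_list (map fst zs) c = count_list (map fst ys) c"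
      using walk_rev[OF ys] by blast
    have "walk G r (xs @ zs) r"
      using xs zs(1) by (auto simp: walk_append)
    then have "even (count_list (map fst (xs @ zs)) c)"
      using odd_closed_walk_imp_odd_cycle[OF pre] no by blast
    then show ?thesis
      using zs(2) by (auto simp: par_def)
  qed
  define s where "s v = (\<exists>xs. walk G r xs v \<and> par xs)" for v
  have s: "s v = par xs" if "walk G r xs v" for xs v
    using uniq that unfolding s_def by blast
  have "alternates_on c G s"
    unfolding alternates_on_def
  proof (intro allI impI)
    fix i u v assume e: "(i, {u, v}) \<in> cedges G"
    then have "u \<in> flags G"
      using pre by (auto elim: pre_maniplex_edgeE)
    then obtain xs where xs: "walk G r xs u"
      using conn r reach_imp_walk unfolding connected_cgraph_def by metis
    then have "walk G r (xs @ [(i, v)]) v"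
      using e by (auto simp: walk_append)
    from s[OF xs] s[OF this] show "s u \<noteq> s v \<longleftrightarrow> i = c"
      by (auto simp: par_def)
  qed
  then show thesis by (rule that)
qed

section \<open>Neighbors\<close>

text \<open>The only \<open>i\<close>-edge at \<open>u\<close> determines its other end, so the
  description in \<open>nb\<close> is well defined.\<close>

lemma edge_iff_nb:
  assumes pre: "pre_maniplex n G" and "u \<in> flags G" and "i < n"
  shows "(i, {u, v}) \<in> cedges G \<longleftrightarrow> v = nb G u i"
proof -
  have "\<exists>!e. (i, e) \<in> cedges G \<and> u \<in> e"
    using assms unfolding pre_maniplex_def by simp
  then obtain e where e: "(i, e) \<in> cedges G" "u \<in> e"
    and uniq: "\<And>e'. (i, e') \<in> cedges G \<Longrightarrow> u \<in> e' \<Longrightarrow> e' = e"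
    by blast
  obtain a b where "e = {a, b}"
    using e(1) pre unfolding pre_maniplex_def by fastforce
  then obtain w where w: "e = {u, w}"
    using e(2) by auto
  have eq: "w' = w" if "(i, {u, w'}) \<in> cedges G" for w'
    using uniq[OF that] w by (auto simp: doubleton_eq_iff)
  have edge: "(i, {u, w}) \<in> cedges G"
    using e(1) w by simp
  have "nb G u i = w"
    unfolding nb_def by (intro the_equality edge eq)
  then show ?thesis
    using eq edge by blast
qed

lemma
  assumes "pre_maniplex n G" and "u \<in> flags G" and "i < n"
  shows nb_in_flags: "nb G u i \<in> flags G"
    and nb_neq: "nb G u i \<noteq> u"
    and nb_nb: "nb G (nb G u i) i = u"
proof -
  have e: "(i, {u, nb G u i}) \<in> cedges G"
    using edge_iff_nb[OF assms] by blast
  then show fl: "nb G u i \<in> flags G" and "nb G u i \<noteq> u"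
    using assms by (auto elim: pre_maniplex_edgeE)
  have "(i, {nb G u i, u}) \<in> cedges G"
    using e by (simp add: insert_commute)
  then show "nb G (nb G u i) i = u"
    using edge_iff_nb[OF assms(1) fl assms(3)] by simp
qed

section \<open>Connected components\<close>

lemma component_of_simps:
  "flags (component_of G u) = {v \<in> flags G. reach G UNIV u v}"
  "cedges (component_of G u) = {(i, e) \<in> cedges G. e \<subseteq> flags (component_of G u)}"
  unfolding component_of_def Let_def by auto

lemma component_of_closed:
  assumes "u \<in> flags (component_of G w)" and "(i, {u, v}) \<in> cedges G" and "v \<in> flags G"
  shows "v \<in> flags (component_of G w)"
proof -
  have "reach G UNIV w u"
    using assms(1) by (simp add: component_of_simps)
  then have "reach G UNIV w v"
    unfolding reach_def using assms(2) by (auto elim!: rtranclp.rtrancl_into_rtrancl)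
  then show ?thesis
    using assms(3) by (simp add: component_of_simps)
qed

lemma component_of_refl: "w \<in> flags G \<Longrightarrow> w \<in> flags (component_of G w)"
  by (simp add: component_of_simps reach_def)

text \<open>A path from \<open>w\<close> never leaves the component, so its edges survive the
  restriction; membership is carried along in the induction.\<close>

lemma reach_component_of:
  assumes edges: "\<And>i e. (i, e) \<in> cedges G \<Longrightarrow> e \<subseteq> flags G"
    and "w \<in> flags G" and "v \<in> flags (component_of G w)"
  shows "reach (component_of G w) UNIV w v"
proof -
  have "reach G UNIV w v"
    using assms(3) by (simp add: component_of_simps)
  then have "v \<in> flags (component_of G w) \<and> reach (component_of G w) UNIV w v"
    unfolding reach_def
  proof (induction rule: rtranclp_induct)
    case base
    show ?case using component_of_refl assms(2) by auto
  next
    case (step y z)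
    then obtain i where e: "(i, {y, z}) \<in> cedges G" by blast
    then have z: "z \<in> flags (component_of G w)"
      using step.IH edges[OF e] component_of_closed[of y G w i z] by auto
    then have "(i, {y, z}) \<in> cedges (component_of G w)"
      using e step.IH by (subst component_of_simps(2)) auto
    then show ?case
      using z step.IH by (metis (mono_tags, lifting) UNIV_I rtranclp.rtrancl_into_rtrancl)
  qed
  then show ?thesis ..
qed

section \<open>Covers by one or two sheets\<close>

text \<open>\<open>p\<close> is the projection of a connected cover \<open>H\<close> of \<open>G\<close>, \<open>q\<close> tells the sheet, and \<open>\<tau>\<close> is the
  exchange of sheets along the edges of color \<open>c\<close>.\<close>

locale sheeted_cover =
  fixes N c k :: nat and G :: "'a cgraph" and H :: "'x cgraph"
    and p :: "'x \<Rightarrow> 'a" and q :: "'x \<Rightarrow> 'b" and \<tau> :: "'b \<Rightarrow> 'b" and x\<^sub>0 :: 'x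
  assumes pre: "pre_maniplex N G" and conn: "connected_cgraph G"
    and p_flags: "\<And>x. x \<in> flags H \<Longrightarrow> p x \<in> flags G"
    and tau_tau: "\<And>x. x \<in> flags H \<Longrightarrow> \<tau> (\<tau> (q x)) = q x"
    and tau_neq: "\<And>x. x \<in> flags H \<Longrightarrow> \<tau> (q x) \<noteq> q x"
    and pq_inj: "\<And>x y. x \<in> flags H \<Longrightarrow> y \<in> flags H \<Longrightarrow> p x = p y \<Longrightarrow> q x = q y \<Longrightarrow> x = y"
    and edge_iff: "\<And>j x y. x \<in> flags H \<Longrightarrow> y \<in> flags H \<Longrightarrow>
      (j, {x, y}) \<in> cedges H \<longleftrightarrow>
        (\<exists>i<N. j = i + k \<and> p y = nb G (p x) i \<and> q y = (if i = c then \<tau> (q x) else q x))"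
    and lift: "\<And>x i. x \<in> flags H \<Longrightarrow> i < N \<Longrightarrow>
      \<exists>y\<in>flags H. p y = nb G (p x) i \<and> q y = (if i = c then \<tau> (q x) else q x)"
    and base: "x\<^sub>0 \<in> flags H"
    and edge_flags: "\<And>i e. (i, e) \<in> cedges H \<Longrightarrow> e \<subseteq> flags H"
    and reach_base: "\<And>x. x \<in> flags H \<Longrightarrow> reach H UNIV x\<^sub>0 x"
begin

text \<open>Induction along a path from \<open>x\<^sub>0\<close>, with each edge seen only through
  \<open>p\<close> and \<open>q\<close>.\<close>

lemma induct_flags [consumes 1, case_names base step]:
  assumes "x \<in> flags H" and "R x\<^sub>0"
    and step: "\<And>y z i. y \<in> flags H \<Longrightarrow> z \<in> flags H \<Longrightarrow> R y \<Longrightarrow> i < N \<Longrightarrow>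
      p z = nb G (p y) i \<Longrightarrow> q z = (if i = c then \<tau> (q y) else q y) \<Longrightarrow> R z"
  shows "R x"
  using reach_base[OF assms(1)] unfolding reach_def
proof (induction rule: rtranclp_induct)
  case base
  show ?case by fact
next
  case (step y z)
  then obtain j where e: "(j, {y, z}) \<in> cedges H" by blast
  then have "y \<in> flags H" "z \<in> flags H"
    using edge_flags by auto
  then show ?case
    using e edge_iff assms(3) step.IH by metis
qed

text \<open>\<tau> is an involution on the occurring sheets, so no edge leads out of the pair formed
  by \<open>q x\<^sub>0\<close> and its partner.\<close>

lemma sheets: "x \<in> flags H \<Longrightarrow> q x = q x\<^sub>0 \<or> q x = \<tau> (q x\<^sub>0)"
  by (induction rule: induct_flags) (use tau_tau base in \<open>auto split: if_splits\<close>)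

lemma iso_imp_no_odd_cycle:
  assumes "cgraph_iso H (shift_colors k G)"
  shows "\<not> has_odd_cycle c G"
proof -
  obtain f where bij: "bij_betw f (flags H) (flags G)"
    and iso: "\<And>i x y. x \<in> flags H \<Longrightarrow> y \<in> flags H \<Longrightarrow>
      (i, {x, y}) \<in> cedges H \<longleftrightarrow> (i, {f x, f y}) \<in> cedges (shift_colors k G)"
    using assms unfolding cgraph_iso_def shift_colors_def by auto
  let ?g = "inv_into (flags H) f"
  have g: "?g u \<in> flags H" "f (?g u) = u" if "u \<in> flags G" for u
    using bij that by (auto simp: bij_betw_def inv_into_into f_inv_into_f)
  \<comment> \<open>A flag of \<open>G\<close> is colored by whether its preimage under
    \<open>f\<close> lies on the sheet of \<open>x\<^sub>0\<close>. Both \<open>f\<close> and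
    \<open>edge_iff\<close> shift colors by \<open>k\<close>, so exactly the edges of color
    \<open>c\<close> exchange the two distinct sheets.\<close>
  have "alternates_on c G (\<lambda>u. q (?g u) = q x\<^sub>0)"
    unfolding alternates_on_def
  proof (intro allI impI)
    fix i u v assume e: "(i, {u, v}) \<in> cedges G"
    then have uv: "u \<in> flags G" "v \<in> flags G"
      using pre by (auto elim: pre_maniplex_edgeE)
    have "(i + k, {f (?g u), f (?g v)}) \<in> cedges (shift_colors k G)"
      using e g uv unfolding shift_colors_def by auto
    then have "(i + k, {?g u, ?g v}) \<in> cedges H"
      using iso g uv by blast
    then have "q (?g v) = (if i = c then \<tau> (q (?g u)) else q (?g u))"
      using edge_iff g(1) uv by auto
    then show "(q (?g u) = q x\<^sub>0) \<noteq> (q (?g v) = q x\<^sub>0) \<longleftrightarrow> i = c"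
      using sheets[OF g(1)[OF uv(1)]] tau_tau[OF base] tau_neq[OF base] by auto
  qed
  then show ?thesis
    by (rule alternates_on_imp_no_odd_cycle)
qed

lemma no_odd_cycle_imp_iso:
  assumes "\<not> has_odd_cycle c G"
  shows "cgraph_iso H (shift_colors k G)"
proof -
  obtain s where s: "alternates_on c G s"
    using no_odd_cycle_imp_alternates_on[OF pre conn assms] .
  have s_nb: "s u \<noteq> s (nb G u i) \<longleftrightarrow> i = c" if "u \<in> flags G" "i < N" for u i
    using s edge_iff_nb[OF pre that] unfolding alternates_on_def by blast
  \<comment> \<open>The sheet and the value of \<open>s\<close> at \<open>p x\<close> change along
    the same edges, so the sheet is a function of \<open>p x\<close>; with \<open>pq_inj\<close>
    this makes \<open>p\<close> injective.\<close>
  have q: "x \<in> flags H \<Longrightarrow> q x = (if s (p x) = s (p x\<^sub>0) then q x\<^sub>0 else \<tau> (q x\<^sub>0))" for x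
  proof (induction rule: induct_flags)
    case (step y z i)
    then show ?case
      using s_nb[OF p_flags[OF step(1)], of i] tau_tau[OF base] by (auto split: if_splits)
  qed simp
  have inj: "inj_on p (flags H)"
    using q pq_inj by (intro inj_onI) metis
  \<comment> \<open>Paths of \<open>G\<close> starting at \<open>p x\<^sub>0\<close> are lifted edge
    by edge, which gives surjectivity.\<close>
  have "u \<in> p ` flags H" if "u \<in> flags G" for u
  proof -
    have "reach G UNIV (p x\<^sub>0) u"
      using conn that p_flags[OF base] unfolding connected_cgraph_def by blast
    then show ?thesis
      unfolding reach_def
    proof (induction rule: rtranclp_induct)
      case base
      show ?case using sheeted_cover.base[OF sheeted_cover_axioms] by blast
    next
      case (step u v)
      then obtain i x where e: "(i, {u, v}) \<in> cedges G" and x: "x \<in> flags H" "u = p x" by blast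
      then have i: "i < N"
        using pre by (auto elim: pre_maniplex_edgeE)
      then have "v = nb G (p x) i"
        using e x edge_iff_nb[OF pre p_flags[OF x(1)]] by blast
      then show ?case
        using lift[OF x(1) i] by (metis image_eqI)
    qed
  qed
  then have bij: "bij_betw p (flags H) (flags G)"
    using inj p_flags unfolding bij_betw_def by blast
  have "(j, {x, y}) \<in> cedges H \<longleftrightarrow> (j, {p x, p y}) \<in> cedges (shift_colors k G)"
    if xy: "x \<in> flags H" "y \<in> flags H" for j x y
  proof -
    have "(j, {p x, p y}) \<in> cedges (shift_colors k G) \<longleftrightarrow>
        (\<exists>i. j = i + k \<and> (i, {p x, p y}) \<in> cedges G)"
      unfolding shift_colors_def by auto
    also have "\<dots> \<longleftrightarrow> (\<exists>i<N. j = i + k \<and> p y = nb G (p x) i)"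
      using edge_iff_nb[OF pre p_flags[OF xy(1)]] pre by (metis pre_maniplex_edgeE)
    \<comment> \<open>The condition on \<open>q\<close> comes for free: the lifted edge ends at a
      flag with projection \<open>p y\<close>, which is \<open>y\<close> by injectivity.\<close>
    also have "\<dots> \<longleftrightarrow> (j, {x, y}) \<in> cedges H"
      using edge_iff[OF xy] lift[OF xy(1)] inj xy(2) by (metis inj_onD)
    finally show ?thesis ..
  qed
  moreover have "flags (shift_colors k G) = flags G"
    by (simp add: shift_colors_def)
  ultimately show ?thesis
    unfolding cgraph_iso_def using bij by auto
qed

lemma iso_iff: "cgraph_iso H (shift_colors k G) \<longleftrightarrow> \<not> has_odd_cycle c G"
  using iso_imp_no_odd_cycle no_odd_cycle_imp_iso by blast

end

section \<open>Components of the flat amalgamation\<close>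

lemma
  assumes "pre_maniplex n P" and "pre_maniplex m Q" and "n \<ge> 1" and "m \<ge> 1"
    and "x \<in> flags P \<times> flags Q" and "j \<le> m + n - 2"
  shows flat_nb_in_flags: "flat_nb n P Q x j \<in> flags P \<times> flags Q"
    and flat_nb_flat_nb: "flat_nb n P Q (flat_nb n P Q x j) j = x"
proof -
  obtain a b where x: "x = (a, b)" "a \<in> flags P" "b \<in> flags Q"
    using assms(5) by blast
  note nbs = nb_in_flags[OF assms(1) x(2)] nb_nb[OF assms(1) x(2)]
    nb_in_flags[OF assms(2) x(3)] nb_nb[OF assms(2) x(3)]
  consider "j < n - 1" | "j = n - 1" | "n - 1 < j" "j - (n - 1) < m"
    using assms(4,6) by linarith
  then have "flat_nb n P Q x j \<in> flags P \<times> flags Q \<and>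
      flat_nb n P Q (flat_nb n P Q x j) j = x"
    using assms(3,4) x nbs by cases (simp_all add: flat_nb_def)
  then show "flat_nb n P Q x j \<in> flags P \<times> flags Q"
    and "flat_nb n P Q (flat_nb n P Q x j) j = x"
    by auto
qed

text \<open>An edge may be generated from either end; \<open>flat_nb\<close> is an involution in
  each color, so both ends give the same relation.\<close>

lemma flat_graph_edge_iff:
  assumes "pre_maniplex n P" and "pre_maniplex m Q" and "n \<ge> 1" and "m \<ge> 1"
    and "x \<in> flags P \<times> flags Q"
  shows "(j, {x, y}) \<in> cedges (flat_graph n m P Q) \<longleftrightarrow> j \<le> m + n - 2 \<and> y = flat_nb n P Q x j"
proof
  assume "(j, {x, y}) \<in> cedges (flat_graph n m P Q)"
  then obtain z where "j \<le> m + n - 2" "z \<in> flags P \<times> flags Q" "{x, y} = {z, flat_nb n P Q z j}"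
    unfolding flat_graph_def by auto
  then show "j \<le> m + n - 2 \<and> y = flat_nb n P Q x j"
    using flat_nb_flat_nb[OF assms(1-4)] by (auto simp: doubleton_eq_iff)
next
  assume "j \<le> m + n - 2 \<and> y = flat_nb n P Q x j"
  then show "(j, {x, y}) \<in> cedges (flat_graph n m P Q)"
    using assms(5) unfolding flat_graph_def by auto
qed

text \<open>Supplies the covers for both choices of \<open>I\<close>. Components are closed under
  edges, so passing to \<open>M\<close> and then to \<open>C\<close> keeps every edge with color in
  \<open>I\<close> at a remaining flag.\<close>

lemma flat_amalgamation_component:
  assumes "pre_maniplex n P" and "pre_maniplex m Q" and "n \<ge> 1" and "m \<ge> 1"
    and M: "M = flat_amalgamation n P \<Phi> m Q \<Psi>"
    and x\<^sub>0: "x\<^sub>0 \<in> flags M" and C: "C = component_of (color_restrict M I) x\<^sub>0"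
  shows "flags C \<subseteq> flags P \<times> flags Q" and "x\<^sub>0 \<in> flags C"
    and "\<And>i e. (i, e) \<in> cedges C \<Longrightarrow> e \<subseteq> flags C"
    and "\<And>x. x \<in> flags C \<Longrightarrow> reach C UNIV x\<^sub>0 x"
    and "\<And>j x y. x \<in> flags C \<Longrightarrow> y \<in> flags C \<Longrightarrow>
      (j, {x, y}) \<in> cedges C \<longleftrightarrow> j \<in> I \<and> j \<le> m + n - 2 \<and> y = flat_nb n P Q x j"
    and "\<And>j x. x \<in> flags C \<Longrightarrow> j \<in> I \<Longrightarrow> j \<le> m + n - 2 \<Longrightarrow> flat_nb n P Q x j \<in> flags C"
proof -
  let ?F = "flat_graph n m P Q" and ?R = "color_restrict M I"
  note edge = flat_graph_edge_iff[OF assms(1-4)]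
  have M_def: "M = component_of ?F (\<Phi>, \<Psi>)"
    using M by (simp add: flat_amalgamation_def)
  have R: "flags ?R = flags M" "cedges ?R = {(i, e) \<in> cedges M. i \<in> I}"
    by (auto simp: color_restrict_def)
  have F: "flags ?F = flags P \<times> flags Q"
    by (simp add: flat_graph_def)
  have MF: "flags M \<subseteq> flags P \<times> flags Q"
    using F by (auto simp: M_def component_of_simps)
  have CM: "flags C \<subseteq> flags M"
    using R(1) by (auto simp: C component_of_simps)
  show CF: "flags C \<subseteq> flags P \<times> flags Q"
    using MF CM by blast
  show "x\<^sub>0 \<in> flags C"
    using component_of_refl x\<^sub>0 R(1) C by metis
  show "e \<subseteq> flags C" if "(i, e) \<in> cedges C" for i e
    using that unfolding C by (subst (asm) component_of_simps(2)) auto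
  have M_edges: "cedges M = {(i, e) \<in> cedges ?F. e \<subseteq> flags M}"
    unfolding M_def by (rule component_of_simps)
  have R_edges: "cedges ?R = {(i, e) \<in> cedges ?F. e \<subseteq> flags M \<and> i \<in> I}"
    using R(2) M_edges by auto
  have C_edges: "cedges C = {(i, e) \<in> cedges ?R. e \<subseteq> flags C}"
    unfolding C by (rule component_of_simps)
  show "reach C UNIV x\<^sub>0 x" if "x \<in> flags C" for x
    using that x\<^sub>0 R(1) R_edges unfolding C by (intro reach_component_of) auto
  show "(j, {x, y}) \<in> cedges C \<longleftrightarrow> j \<in> I \<and> j \<le> m + n - 2 \<and> y = flat_nb n P Q x j"
    if "x \<in> flags C" "y \<in> flags C" for j x y
    using that CM CF edge[of x j y] by (auto simp: C_edges R_edges)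
  show "flat_nb n P Q x j \<in> flags C" if x: "x \<in> flags C" and j: "j \<in> I" "j \<le> m + n - 2" for j x
  proof -
    let ?y = "flat_nb n P Q x j"
    have xF: "x \<in> flags P \<times> flags Q"
      using x CF by blast
    have e: "(j, {x, ?y}) \<in> cedges ?F"
      using edge[OF xF] j by simp
    have "?y \<in> flags ?F"
      using flat_nb_in_flags[OF assms(1-4) xF j(2)] F by simp
    then have yM: "?y \<in> flags M"
      using component_of_closed[of x ?F] e x CM unfolding M_def by blast
    then have "(j, {x, ?y}) \<in> cedges ?R"
      using e x CM j R_edges by auto
    then show ?thesis
      using component_of_closed[of x ?R x\<^sub>0 j ?y] x yM R(1) unfolding C by blast
  qed
qed

section \<open>The two equivalences for the flat amalgamation\<close>

theorem proposition4p3: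
  fixes n m :: nat
    and P :: "'a cgraph" and \<Phi> :: 'a
    and Q :: "'b cgraph" and \<Psi> :: 'b
    and M :: "('a \<times> 'b) cgraph"
  assumes "n \<ge> 1" and "m \<ge> 1"
    and "polytope n P" and "\<Phi> \<in> flags P"
    and "polytope m Q" and "\<Psi> \<in> flags Q"
    and "M = flat_amalgamation n P \<Phi> m Q \<Psi>"
  shows "((\<forall>C \<in> components_of (color_restrict M {0..n - 1}). cgraph_iso C P)
            \<longleftrightarrow> facet_bipartite n P) \<and>
         ((\<forall>C \<in> components_of (color_restrict M {n - 1..m + n - 2}).
             cgraph_iso C (shift_colors (n - 1) Q))
            \<longleftrightarrow> vertex_bipartite Q)"
proof -
  have P: "pre_maniplex n P" "connected_cgraph P" and Q: "pre_maniplex m Q" "connected_cgraph Q"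
    using assms by (auto simp: polytope_def maniplex_def)
  note comp = flat_amalgamation_component[OF P(1) Q(1) assms(1,2,7)]
  \<comment> \<open>The bipartiteness conditions do not mention the component, so at least one
    component is needed to keep the universal statements from being vacuous.\<close>
  have "(\<Phi>, \<Psi>) \<in> flags M"
    using assms by (simp add: flat_amalgamation_def component_of_refl flat_graph_def)
  then have ne: "components_of (color_restrict M I) \<noteq> {}" for I
    by (auto simp: components_of_def color_restrict_def)
  have ex: "\<exists>x\<^sub>0. x\<^sub>0 \<in> flags M \<and> C = component_of (color_restrict M I) x\<^sub>0"
    if "C \<in> components_of (color_restrict M I)" for C I
    using that by (auto simp: components_of_def color_restrict_def)
  have shift0: "shift_colors 0 P = P"
    by (simp add: shift_colors_def)
  have 1: "cgraph_iso C P \<longleftrightarrow> \<not> has_odd_cycle (n - 1) P"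
    if C: "C \<in> components_of (color_restrict M {0..n - 1})" for C
  proof -
    obtain x\<^sub>0 where x\<^sub>0: "x\<^sub>0 \<in> flags M" "C = component_of (color_restrict M {0..n - 1}) x\<^sub>0"
      using ex[OF C] by blast
    note c = comp[OF x\<^sub>0]
    have fl: "fst x \<in> flags P" "snd x \<in> flags Q" if "x \<in> flags C" for x
      using c(1) that by auto
    have nb_eq: "flat_nb n P Q x j =
        (nb P (fst x) j, if j = n - 1 then nb Q (snd x) 0 else snd x)" if "j < n" for x j
      using that by (auto simp: flat_nb_def)
    \<comment> \<open>The sheet is the flag of \<open>Q\<close>, which color \<open>n - 1\<close>
      exchanges with its \<open>0\<close>-neighbor: a fixed-point-free involution.\<close>
    have "sheeted_cover n (n - 1) 0 P C fst snd (\<lambda>d. nb Q d 0) x\<^sub>0"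
    proof
      fix j x y assume "x \<in> flags C" "y \<in> flags C"
      then show "(j, {x, y}) \<in> cedges C \<longleftrightarrow> (\<exists>i<n. j = i + 0 \<and> fst y = nb P (fst x) i \<and>
          snd y = (if i = n - 1 then nb Q (snd x) 0 else snd x))"
        using c(5)[of x y j] assms(1,2) nb_eq[of j x] by (cases "j < n") (auto simp: prod_eq_iff)
    next
      fix x i assume "x \<in> flags C" "i < n"
      then show "\<exists>y\<in>flags C. fst y = nb P (fst x) i \<and>
          snd y = (if i = n - 1 then nb Q (snd x) 0 else snd x)"
        using c(6)[of x i] assms(1,2) nb_eq[of i x] by (intro bexI[of _ "flat_nb n P Q x i"]) auto
    qed (use assms(2) in \<open>auto simp: P fl nb_nb[OF Q(1)] nb_neq[OF Q(1)] prod_eq_iff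
        intro: c(2,4) c(3)[THEN subsetD]\<close>)
    from sheeted_cover.iso_iff[OF this] show ?thesis
      by (simp add: shift0)
  qed
  have 2: "cgraph_iso C (shift_colors (n - 1) Q) \<longleftrightarrow> \<not> has_odd_cycle 0 Q"
    if C: "C \<in> components_of (color_restrict M {n - 1..m + n - 2})" for C
  proof -
    obtain x\<^sub>0 where x\<^sub>0: "x\<^sub>0 \<in> flags M" "C = component_of (color_restrict M {n - 1..m + n - 2}) x\<^sub>0"
      using ex[OF C] by blast
    note c = comp[OF x\<^sub>0]
    have fl: "fst x \<in> flags P" "snd x \<in> flags Q" if "x \<in> flags C" for x
      using c(1) that by auto
    have nb_eq: "flat_nb n P Q x (i + (n - 1)) =
        (if i = 0 then nb P (fst x) (n - 1) else fst x, nb Q (snd x) i)" for x i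
      by (auto simp: flat_nb_def)
    \<comment> \<open>Color \<open>i\<close> of \<open>Q\<close> appears as
      \<open>i + (n - 1)\<close>, so the exchanging color is \<open>0\<close> in \<open>Q\<close>;
      it moves the sheet, a flag of \<open>P\<close>, to its neighbor of color
      \<open>n - 1\<close>.\<close>
    have "sheeted_cover m 0 (n - 1) Q C snd fst (\<lambda>d. nb P d (n - 1)) x\<^sub>0"
    proof
      fix j x y assume xy: "x \<in> flags C" "y \<in> flags C"
      \<comment> \<open>The top color is \<open>(m - 1) + (n - 1)\<close>, so the interval consists
        of exactly the shifted colors of \<open>Q\<close>.\<close>
      have "j \<in> {n - 1..m + n - 2} \<longleftrightarrow> (\<exists>i<m. j = i + (n - 1))"
        unfolding atLeastAtMost_iff using assms(1,2) by presburger
      then have "(j, {x, y}) \<in> cedges C \<longleftrightarrow>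
          (\<exists>i<m. j = i + (n - 1) \<and> y = flat_nb n P Q x (i + (n - 1)))"
        using c(5)[OF xy, of j] by (metis atLeastAtMost_iff)
      then show "(j, {x, y}) \<in> cedges C \<longleftrightarrow> (\<exists>i<m. j = i + (n - 1) \<and> snd y = nb Q (snd x) i \<and>
          fst y = (if i = 0 then nb P (fst x) (n - 1) else fst x))"
        unfolding nb_eq prod_eq_iff fst_conv snd_conv by blast
    next
      fix x i assume "x \<in> flags C" "i < m"
      moreover from this have "i + (n - 1) \<in> {n - 1..m + n - 2}" "i + (n - 1) \<le> m + n - 2"
        using assms(1) by auto
      ultimately have "flat_nb n P Q x (i + (n - 1)) \<in> flags C"
        by (intro c(6))
      then show "\<exists>y\<in>flags C. snd y = nb Q (snd x) i \<and>
          fst y = (if i = 0 then nb P (fst x) (n - 1) else fst x)"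
        unfolding nb_eq by (rule bexI[rotated]) simp
    qed (use assms(1) in \<open>auto simp: Q fl nb_nb[OF P(1)] nb_neq[OF P(1)] prod_eq_iff
        intro: c(2,4) c(3)[THEN subsetD]\<close>)
    from sheeted_cover.iso_iff[OF this] show ?thesis .
  qed
  show ?thesis
    using 1 2 ne unfolding facet_bipartite_def vertex_bipartite_def has_odd_cycle_def by blast
qed

end
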